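(* Let $P_1$ and $P_2$ be palindromes occurring in a word $w$, with centres $c_1$ and $c_2$ respectively and radii $r_1$ and $r_2$ respectively, so that $P_1=w[c_1-r_1\dots c_1+r_1]$ and $P_2=w[c_2-r_2\dots c_2+r_2]$, and suppose $c_2>c_1$. If $P_1$ and $P_2$ contain each other's centres and neither is a proper factor of the other, then their union is a palindromic periodicity with period $2(c_2-c_1)$.
   Context: Words are finite sequences of letters $w=w[1]w[2]\cdots w[n]$, $|w|=n$, and $w[i\dots j]$ denotes the factor occupying positions $i$ to $j$. A word is a palindrome if it equals its reverse; the empty word is a palindrome. If $w[i\dots j]$ is a palindrome, its centre is $c=(i+j)/2$ and its radius is $r=(j-i)/2$ (both are integers, or both are integers plus $1/2$). Palindromes in $w$ are considered as occurrences, i.e. together with their positions. Convention for containing a centre: an integer position $x$ is in $w[a\dots b]$ if $a\le x\le b$; for half-integer positions, $a-1/2$ is regarded as being in $w[a\dots b]$ but $b+1/2$ is not. Thus $w[a\dots b]$ contains the centre $c$ if and only if $a-1/2\le c\le b$. An occurrence $w[c\dots d]$ is a proper factor of $w[a\dots b]$ if it lies inside it and is neither a prefix nor a suffix of it, i.e. $a<c\le d<b$. The union of two overlapping occurrences is the factor of $w$ occupying all positions covered by at least one of them. For a nonempty word $x$, $x^\omega=xxx\cdots$. A word $v$ is a palindromic periodicity with period $q$ (where $q\ge 1$ is an integer) if there are palindromes $p$ and $s$ (either of which may be empty) with $|ps|=q$ such that $v$ is a factor of $(ps)^\omega$ and $|v|\ge q$. *)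

theory Defs
  imports Complex_Main "HOL-Library.Stream"
begin

definition palindrome :: "'a list \<Rightarrow> bool" where
  "palindrome u \<longleftrightarrow> rev u = u"

text \<open>
  Positions of a word are numbered from 1, and \<open>factor w i j\<close> is \<open>w[i..j]\<close>.  It is only used for
  \<open>occurrence w i j\<close>, which also allows the empty occurrences \<open>w[i..i-1]\<close>.
\<close>

definition factor :: "'a list \<Rightarrow> nat \<Rightarrow> nat \<Rightarrow> 'a list" where
  "factor w i j = take (Suc j - i) (drop (i - 1) w)"

definition occurrence :: "'a list \<Rightarrow> nat \<Rightarrow> nat \<Rightarrow> bool" where
  "occurrence w i j \<longleftrightarrow> 1 \<le> i \<and> i \<le> j + 1 \<and> j \<le> length w"

definition palindrome_occurrence :: "'a list \<Rightarrow> nat \<Rightarrow> nat \<Rightarrow> bool" where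
  "palindrome_occurrence w i j \<longleftrightarrow> occurrence w i j \<and> palindrome (factor w i j)"

definition centre :: "nat \<Rightarrow> nat \<Rightarrow> real" where
  "centre i j = (real i + real j) / 2"

definition radius :: "nat \<Rightarrow> nat \<Rightarrow> real" where
  "radius i j = (real j - real i) / 2"

text \<open>
  The asymmetry is intended: for half-integer centres, \<open>a - 1/2\<close> counts as lying in \<open>w[a..b]\<close>,
  but \<open>b + 1/2\<close> does not.  In particular an empty occurrence contains no centre.
\<close>

definition contains_centre :: "nat \<Rightarrow> nat \<Rightarrow> real \<Rightarrow> bool" where
  "contains_centre a b c \<longleftrightarrow> real a - 1/2 \<le> c \<and> c \<le> real b"

text \<open>\<open>w[c..d]\<close> is a proper factor of \<open>w[a..b]\<close>: inside it, and neither a prefix nor a suffix.\<close>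

definition proper_factor :: "nat \<Rightarrow> nat \<Rightarrow> nat \<Rightarrow> nat \<Rightarrow> bool" where
  "proper_factor c d a b \<longleftrightarrow> a < c \<and> c \<le> d \<and> d < b"

text \<open>
  The union of \<open>w[a..b]\<close> and \<open>w[c..d]\<close>, meaningful when the two occurrences overlap; the lemma
  \<open>overlapping_positions\<close> confirms that it then occupies exactly the positions covered by
  at least one of them.
\<close>

definition union_factor :: "'a list \<Rightarrow> nat \<Rightarrow> nat \<Rightarrow> nat \<Rightarrow> nat \<Rightarrow> 'a list" where
  "union_factor w a b c d = factor w (min a c) (max b d)"

definition factor_of_infinite :: "'a list \<Rightarrow> 'a stream \<Rightarrow> bool" where
  "factor_of_infinite v x \<longleftrightarrow> (\<exists>u t. x = u @- v @- t)"

text \<open>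
  \<open>cycle x\<close> is \<open>x x x ...\<close> for nonempty \<open>x\<close>; the condition \<open>1 \<le> q\<close> guarantees
  that \<open>p @ s\<close> is nonempty.
\<close>

definition palindromic_periodicity :: "'a list \<Rightarrow> nat \<Rightarrow> bool" where
  "palindromic_periodicity v q \<longleftrightarrow>
     1 \<le> q \<and>
     (\<exists>p s. palindrome p \<and> palindrome s \<and> length (p @ s) = q \<and>
            factor_of_infinite v (cycle (p @ s)) \<and> q \<le> length v)"

lemma nth_factor:
  assumes "occurrence w i j" "i + k \<le> j"
  shows "factor w i j ! k = w ! (i + k - 1)"
  using assms by (auto simp: factor_def occurrence_def nth_drop)

lemma length_factor:
  assumes "occurrence w i j"
  shows "length (factor w i j) = Suc j - i"
  using assms by (auto simp: factor_def occurrence_def)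

lemma centre_radius:
  "centre i j - radius i j = real i" "centre i j + radius i j = real j"
  by (simp_all add: centre_def radius_def field_simps)

lemma overlapping_positions:
  assumes "{a..b} \<inter> {c..d} \<noteq> {}"
  shows "{min a c..max b d} = {a..b} \<union> {c..(d::nat)}"
  using assms by (auto simp: min_def max_def split: if_splits)

end

theory Submission imports Defs begin

text \<open>
  Reflecting a position first in \<open>c\<^sub>1\<close> and then in \<open>c\<^sub>2\<close> moves it \<open>2 * (c\<^sub>2 - c\<^sub>1)\<close> places to the right.
  Since neither palindrome is a proper factor of the other and \<open>c\<^sub>1 < c\<^sub>2\<close>, the first palindrome
  neither starts nor ends later than the second, so the union begins where the first begins and
  ends where the second ends. Every
  position of the union whose translate is still in the union lies in the first palindrome, and its
  mirror image lies in the second; hence the letter is preserved and the union has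
  period \<open>q = 2 * (c\<^sub>2 - c\<^sub>1)\<close> (\<open>union_has_period\<close>).

  It remains to exhibit one period of the union as a product of two palindromes. If two adjacent
  factors have centres \<open>c\<^sub>1\<close> and \<open>c\<^sub>2\<close>, then their total length is automatically \<open>q\<close>, wherever the cut
  between them is made; and each is a palindrome provided that it stays within the palindrome having
  the same centre (\<open>palindrome_occurrence_shrink\<close>). Cutting immediately after \<open>c\<^sub>1\<close> achieves this,
  because the palindromes contain each other's centres. A word with period \<open>q\<close> is a factor of the
  infinite repetition of any of its blocks of length \<open>q\<close> (\<open>periodic_factor_of_cycle\<close>).
\<close>

section \<open>Words with a period\<close>

lemma snth_cycle:
  assumes "u \<noteq> []"
  shows "cycle u !! n = u ! (n mod length u)"
proof -
  have "sdrop (n mod length u) (cycle u) = sdrop n (cycle u)"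
    using assms sdrop_cycle by (metis mod_mod_trivial)
  then have "cycle u !! n = cycle u !! (n mod length u)"
    by (metis sdrop_simps(1))
  also have "\<dots> = (u @- cycle u) !! (n mod length u)"
    using cycle_decomp[OF assms] by simp
  finally show ?thesis
    using assms by (simp add: shift_snth_less)
qed

lemma nth_mod_period:
  assumes period: "\<And>k. k + q < length v \<Longrightarrow> v ! (k + q) = v ! k"
    and "k < length v"
  shows "v ! k = v ! (k mod q)"
  using \<open>k < length v\<close>
proof (induction k rule: less_induct)
  case (less k)
  show ?case
  proof (cases "q = 0 \<or> k < q")
    case True
    then show ?thesis by auto
  next
    case False
    then have "v ! k = v ! (k - q)"
      using period[of "k - q"] less.prems by simp
    also have "\<dots> = v ! ((k - q) mod q)"
      using less False by simp
    finally show ?thesis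
      using False by (simp add: le_mod_geq)
  qed
qed

lemma factor_of_infiniteI:
  assumes "\<And>k. k < length v \<Longrightarrow> v ! k = x !! (n + k)"
  shows "factor_of_infinite v x"
proof -
  have "v = stake (length v) (sdrop n x)"
    using assms by (intro nth_equalityI) (simp_all add: sdrop_snth)
  then have "x = stake n x @- v @- sdrop (length v) (sdrop n x)"
    by (metis stake_sdrop)
  then show ?thesis
    unfolding factor_of_infinite_def by blast
qed

text \<open>The block may start at any offset \<open>m\<close>, which only changes where \<open>v\<close> starts in the repetition.\<close>

lemma periodic_factor_of_cycle:
  assumes period: "\<And>k. k + q < length v \<Longrightarrow> v ! (k + q) = v ! k"
    and "1 \<le> q" "m + q \<le> length v"
  shows "factor_of_infinite v (cycle (take q (drop m v)))"
proof (rule factor_of_infiniteI)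
  fix k
  assume k: "k < length v"
  let ?u = "take q (drop m v)"
  (* The starting point s is chosen with m + s divisible by q. *)
  define s where "s = m * (q - 1)"
  have "m + s = m * q"
    using \<open>1 \<le> q\<close> by (cases q) (simp_all add: s_def)
  have len: "length ?u = q"
    using assms by simp
  have lt: "(s + k) mod q < q"
    using \<open>1 \<le> q\<close> by simp
  have "cycle ?u !! (s + k) = ?u ! ((s + k) mod q)"
    using snth_cycle[of ?u "s + k"] len \<open>1 \<le> q\<close> by force
  also have "\<dots> = v ! (m + (s + k) mod q)"
    using lt assms by simp
  also have "\<dots> = v ! ((m + (s + k) mod q) mod q)"
  proof (intro nth_mod_period period)
    show "m + (s + k) mod q < length v"
      using lt assms(3) by linarith
  qed
  also have "(m + (s + k) mod q) mod q = k mod q"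
    using \<open>m + s = m * q\<close> by (metis add.assoc mod_add_right_eq mod_mult_self3)
  also have "v ! (k mod q) = v ! k"
    using nth_mod_period[OF period k] by simp
  finally show "v ! k = cycle ?u !! (s + k)"
    by simp
qed

section \<open>Palindromic occurrences as reflections\<close>

lemma factor_append:
  assumes "1 \<le> a" "a \<le> b" "b \<le> d + 1"
  shows "factor w a (b - 1) @ factor w b d = factor w a d"
proof -
  have "Suc d - a = (b - a) + (Suc d - b)" "(b - a) + (a - 1) = b - 1" "Suc (b - 1) - a = b - a"
    using assms by auto
  then show ?thesis
    unfolding factor_def by (simp only: take_add drop_drop)
qed

lemma palindrome_occurrence_iff:
  "palindrome_occurrence w i j \<longleftrightarrow>
     occurrence w i j \<and> (\<forall>x. i \<le> x \<and> x \<le> j \<longrightarrow> w ! (x - 1) = w ! (i + j - x - 1))"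
proof (cases "occurrence w i j")
  case True
  have "palindrome (factor w i j) \<longleftrightarrow>
      (\<forall>k < Suc j - i. factor w i j ! (Suc j - i - Suc k) = factor w i j ! k)"
    using length_factor[OF True]
    by (auto simp: palindrome_def list_eq_iff_nth_eq rev_nth)
  also have "\<dots> \<longleftrightarrow> (\<forall>k < Suc j - i. w ! (j - k - 1) = w ! (i + k - 1))"
    using nth_factor[OF True] by (auto simp: algebra_simps)
  also have "\<dots> \<longleftrightarrow> (\<forall>x. i \<le> x \<and> x \<le> j \<longrightarrow> w ! (x - 1) = w ! (i + j - x - 1))"
  proof safe
    fix x
    assume "\<forall>k < Suc j - i. w ! (j - k - 1) = w ! (i + k - 1)" "i \<le> x" "x \<le> j"
    then show "w ! (x - 1) = w ! (i + j - x - 1)"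
      by (auto dest!: spec[of _ "j - x"])
  next
    fix k
    assume "\<forall>x. i \<le> x \<and> x \<le> j \<longrightarrow> w ! (x - 1) = w ! (i + j - x - 1)" "k < Suc j - i"
    then show "w ! (j - k - 1) = w ! (i + k - 1)"
      by (auto dest!: spec[of _ "i + k"])
  qed
  finally show ?thesis
    using True by (simp add: palindrome_occurrence_def)
qed (simp add: palindrome_occurrence_def)

lemma palindrome_occurrence_shrink:
  assumes "palindrome_occurrence w i j" "i \<le> a" "a \<le> b + 1" "a + b = i + j"
  shows "palindrome_occurrence w a b"
  using assms unfolding palindrome_occurrence_iff by (auto simp: occurrence_def)

lemma union_has_period:
  assumes P1: "palindrome_occurrence w i1 j1" and P2: "palindrome_occurrence w i2 j2"
    and "i1 \<le> i2" "j1 \<le> j2" "i1 \<le> x" "x + q \<le> j2" "i1 + j1 + q = i2 + j2"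
  shows "w ! (x + q - 1) = w ! (x - 1)"
proof -
  have "i1 \<le> x \<and> x \<le> j1"
    using assms by linarith
  then have "w ! (x - 1) = w ! (i1 + j1 - x - 1)"
    using P1 unfolding palindrome_occurrence_iff by blast
  moreover have "i2 \<le> i1 + j1 - x \<and> i1 + j1 - x \<le> j2" "i2 + j2 - (i1 + j1 - x) = x + q"
    using assms by linarith+
  then have "w ! (i1 + j1 - x - 1) = w ! (x + q - 1)"
    using P2 unfolding palindrome_occurrence_iff by metis
  ultimately show ?thesis
    by simp
qed

section \<open>The union of two palindromes\<close>

theorem theorem2p3:
  fixes w :: "'a list"
    and i1 j1 i2 j2 :: nat
    and c1 c2 r1 r2 :: real
  assumes "palindrome_occurrence w i1 j1"
    and "palindrome_occurrence w i2 j2"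
    and "c1 = centre i1 j1" and "r1 = radius i1 j1"
    and "c2 = centre i2 j2" and "r2 = radius i2 j2"
    and "c2 > c1"
    and "contains_centre i1 j1 c2"
    and "contains_centre i2 j2 c1"
    and "\<not> proper_factor i1 j1 i2 j2"
    and "\<not> proper_factor i2 j2 i1 j1"
  shows "\<exists>q::nat. real q = 2 * (c2 - c1) \<and>
           palindromic_periodicity (union_factor w i1 j1 i2 j2) q"
proof -
  have occ: "1 \<le> i1" "1 \<le> i2" "j1 \<le> length w" "j2 \<le> length w"
    using assms by (auto simp: palindrome_occurrence_def occurrence_def)
  have "real (i1 + j1) < real (i2 + j2)" "real (2 * i1) \<le> real (i2 + j2 + 1)"
    "real (i2 + j2) \<le> real (2 * j1)" "real (2 * i2) \<le> real (i1 + j1 + 1)"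
    "real (i1 + j1) \<le> real (2 * j2)"
    using assms(7-9) unfolding assms(3,5) contains_centre_def centre_def
    by (simp_all add: field_simps)
  then have c: "i1 + j1 < i2 + j2" "2 * i1 \<le> i2 + j2 + 1"
    "i2 + j2 \<le> 2 * j1" "2 * i2 \<le> i1 + j1 + 1" "i1 + j1 \<le> 2 * j2"
    unfolding of_nat_less_iff of_nat_le_iff by auto
  have le: "i1 \<le> i2" "j1 \<le> j2"
    using assms(10,11) c unfolding proper_factor_def by linarith+
  define q where "q = (i2 + j2) - (i1 + j1)"
  have q: "1 \<le> q" "i1 + j1 + q = i2 + j2"
    using c by (auto simp: q_def)
  have "real (i1 + j1) + real q = real (i2 + j2)"
    using q(2) by (metis of_nat_add)
  then have real_q: "real q = 2 * (c2 - c1)"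
    unfolding assms(3,5) centre_def by (simp add: field_simps)

  define v where "v = factor w i1 j2"
  have union: "union_factor w i1 j1 i2 j2 = v"
    using le by (simp add: union_factor_def v_def min_def max_def)
  have occ_v: "occurrence w i1 j2"
    using occ c le by (simp add: occurrence_def)
  have len_v: "length v = Suc j2 - i1"
    using length_factor[OF occ_v] by (simp add: v_def)
  have nth_v: "v ! k = w ! (i1 + k - 1)" if "k < length v" for k
    using nth_factor[OF occ_v, of k] that len_v by (simp add: v_def)
  have period: "v ! (k + q) = v ! k" if "k + q < length v" for k
    using union_has_period[OF assms(1,2) le, of "i1 + k" q] nth_v[of k] nth_v[of "k + q"]
      that len_v q by (simp add: add.assoc)

  (* b is the first position after c1, and w[a..b-1], w[b..d] are the factors with
     centres c1 and c2 that meet there; the first of them has at most one letter. *)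
  define b where "b = (i1 + j1 + 2) div 2"
  define a where "a = i1 + j1 + 1 - b"
  define d where "d = i2 + j2 - b"
  have "i1 + j1 + 1 \<le> 2 * b" "2 * b \<le> i1 + j1 + 2"
    by (auto simp: b_def)
  then have bounds: "i1 \<le> a" "a \<le> b" "a + (b - 1) = i1 + j1" "1 \<le> b"
    "i2 \<le> b" "b \<le> d + 1" "b + d = i2 + j2" "a + q = d + 1" "d \<le> j2"
    using c le q occ unfolding a_def d_def by linarith+
  have p: "palindrome (factor w a (b - 1))"
    using palindrome_occurrence_shrink[OF assms(1), of a "b - 1"] bounds
    by (simp add: palindrome_occurrence_def)
  have s: "palindrome (factor w b d)"
    using palindrome_occurrence_shrink[OF assms(2), of b d] bounds
    by (simp add: palindrome_occurrence_def)
  have ps: "factor w a (b - 1) @ factor w b d = take q (drop (a - i1) v)"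
  proof -
    have "factor w a d = take q (drop (a - i1) v)"
    proof -
      have "q \<le> Suc j2 - i1 - (a - i1)" "(a - i1) + (i1 - 1) = a - 1" "Suc d - a = q"
        using bounds occ by linarith+
      then show ?thesis
        unfolding factor_def v_def
        by (simp only: drop_take take_take drop_drop min.absorb1)
    qed
    then show ?thesis
      using factor_append[of a b d w] bounds occ by simp
  qed
  have fits: "(a - i1) + q \<le> length v"
    using bounds len_v by linarith
  have "factor_of_infinite v (cycle (factor w a (b - 1) @ factor w b d))"
    unfolding ps using periodic_factor_of_cycle[OF period q(1) fits] .
  moreover have "length (factor w a (b - 1) @ factor w b d) = q"
    unfolding ps using fits by simp
  ultimately have "palindromic_periodicity v q"
    unfolding palindromic_periodicity_def using p s q(1) fits by fastforce
  then show ?thesis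
    using real_q union by blast
qed

end
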